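(* Let $d\ge 1$ and let $\mathcal{G}$ be a $d$-dimensional Cartesian grid of uniform grid width $h=(h_1,\dots,h_d)$, $h_i>0$. Let $E\in\mathcal{G}$ be a fixed element with neighbors $E_i^{\pm}=E\pm h_i e_i$, $i=1,\dots,d$, so that $\mathcal{N}(E)=\{E_i^{+},E_i^{-}\mid i=1,\dots,d\}$. Let $u_E\in\mathbb{R}$ and $u_{E'}\in\mathbb{R}$, $E'\in\mathcal{N}(E)$, be given cell averages, and let $\omega_{E,E'}\ge 0$, $E'\in\mathcal{N}(E)$, be weights such that $$\operatorname{span}\{\omega_{E,E'}(x_{E'}-x_E)\mid E'\in\mathcal{N}(E)\}=\mathbb{R}^d .$$ Consider the quadratic programming problem in the unknown $\nabla w\in\mathbb{R}^d$: $$\text{minimize}\quad \tfrac12\,\nabla w\cdot(H\nabla w)-g\cdot\nabla w$$ $$\text{subject to}\quad 0\le \operatorname{sign}(m_{E,E'})\,d_{E,E'}\cdot\nabla w\le |m_{E,E'}|\quad\text{for all }E'\in\mathcal{N}(E),$$ where $d_{E,E'}=x_{E'}-x_E$, $m_{E,E'}=u_{E'}-u_E$, and $$H=\sum_{E'\in\mathcal{N}(E)}\omega_{E,E'}\,d_{E,E'}\otimes d_{E,E'},\qquad g=\sum_{E'\in\mathcal{N}(E)}\omega_{E,E'}\,m_{E,E'}\,d_{E,E'} .$$ Then the exact solution $\nabla w_E$ of this problem is $$\nabla w_E=\sum_{i=1}^d \operatorname{minmod}\left(\frac{u_{E_i^+}-u_E}{h_i},\frac{u_E-u_{E_i^-}}{h_i}\right)e_i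 .$$ In particular, $\nabla w_E$ is independent of the choice of the weights $\omega_{E,E_i^{\pm}}$.
   Context: The elements of a Cartesian grid of uniform width $h=(h_1,\dots,h_d)$ are closed axis-parallel boxes with side lengths $h_1,\dots,h_d$, all translates of one another by integer multiples of $h_i e_i$, where $e_1,\dots,e_d$ is the standard basis of $\mathbb{R}^d$. $\mathcal{N}(E)$ denotes the set of elements $E'\ne E$ sharing a $(d-1)$-dimensional face with $E$; at the domain boundary, exterior ghost cells with prescribed ghost values play the role of the missing neighbors, so the fixed element $E$ has exactly the $2d$ neighbors $E_i^{\pm}=E\pm h_i e_i$ (translates of $E$). $x_E$ denotes the centroid of $E$. The data $u$ are scalar and piecewise constant, with value $u_E$ on the cell $E$. $\operatorname{sign}(a)\in\{-1,1\}$ denotes the sign of $a\in\mathbb{R}$ (either value may be used when $a=0$). $a\otimes b$ denotes the matrix $(a_i b_j)_{i,j}$. The function $\operatorname{minmod}:\mathbb{R}^2\to\mathbb{R}$ is the usual one: $\operatorname{minmod}(a,b)=\operatorname{sign}(a)\min\{|a|,|b|\}$ if $ab>0$, and $\operatorname{minmod}(a,b)=0$ otherwise. *)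

theory Defs
  imports "HOL-Analysis.Analysis"
begin

text \<open>
  A cell is a subset of \<open>\<real>\<^sup>d\<close>, the type \<open>real ^ 'd\<close>. The extents of a grid (which part of
  space it covers) are left arbitrary.
\<close>

definition lattice_vector :: "real ^ 'd \<Rightarrow> int ^ 'd \<Rightarrow> real ^ 'd" where
  "lattice_vector h k = (\<chi> i. of_int (k $ i) * h $ i)"

definition cartesian_grid :: "real ^ 'd \<Rightarrow> (real ^ 'd) set set \<Rightarrow> bool" where
  "cartesian_grid h G \<longleftrightarrow>
     (\<forall>E\<in>G. \<exists>a. E = cbox a (a + h)) \<and>
     (\<forall>E\<in>G. \<forall>E'\<in>G. \<exists>k. E' = (+) (lattice_vector h k) ` E)"

text \<open>
  Exterior ghost cells stand in for the missing neighbors at the domain boundary, so neighbors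
  are sought among all lattice translates of the cells of the grid, whether or not they belong
  to the grid itself.
\<close>

definition with_ghost_cells :: "real ^ 'd \<Rightarrow> (real ^ 'd) set set \<Rightarrow> (real ^ 'd) set set" where
  "with_ghost_cells h G = {(+) (lattice_vector h k) ` E | k E. E \<in> G}"

definition neighbors :: "real ^ 'd \<Rightarrow> (real ^ 'd) set set \<Rightarrow> (real ^ 'd) set \<Rightarrow> (real ^ 'd) set set" where
  "neighbors h G E =
     {E' \<in> with_ghost_cells h G. E' \<noteq> E \<and>
        (\<exists>F. F face_of E \<and> F face_of E' \<and> aff_dim F = int CARD('d) - 1)}"

definition cell_plus :: "real ^ 'd \<Rightarrow> (real ^ 'd) set \<Rightarrow> 'd \<Rightarrow> (real ^ 'd) set" where
  "cell_plus h E i = (+) (h $ i *\<^sub>R axis i 1) ` E"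

definition cell_minus :: "real ^ 'd \<Rightarrow> (real ^ 'd) set \<Rightarrow> 'd \<Rightarrow> (real ^ 'd) set" where
  "cell_minus h E i = (+) (- (h $ i *\<^sub>R axis i 1)) ` E"

definition centroid :: "(real ^ 'd) set \<Rightarrow> real ^ 'd" where
  "centroid E = (1 / measure lebesgue E) *\<^sub>R integral E (\<lambda>x. x)"

text \<open>The value at 0 is deliberately left open, up to being \<open>-1\<close> or \<open>1\<close>.\<close>

definition is_sign_function :: "(real \<Rightarrow> real) \<Rightarrow> bool" where
  "is_sign_function s \<longleftrightarrow>
     (\<forall>a. s a \<in> {-1, 1} \<and> (a > 0 \<longrightarrow> s a = 1) \<and> (a < 0 \<longrightarrow> s a = -1))"

text \<open>The library's \<^const>\<open>sgn\<close> has value 0 at 0, but here it is applied to nonzero \<open>a\<close> only.\<close>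

definition minmod :: "real \<Rightarrow> real \<Rightarrow> real" where
  "minmod a b = (if a * b > 0 then sgn a * min \<bar>a\<bar> \<bar>b\<bar> else 0)"

definition outer_product :: "real ^ 'd \<Rightarrow> real ^ 'd \<Rightarrow> real ^ 'd ^ 'd" where
  "outer_product a b = (\<chi> i j. a $ i * b $ j)"

definition displacement :: "(real ^ 'd) set \<Rightarrow> (real ^ 'd) set \<Rightarrow> real ^ 'd" where
  "displacement E E' = centroid E' - centroid E"

definition value_jump :: "((real ^ 'd) set \<Rightarrow> real) \<Rightarrow> (real ^ 'd) set \<Rightarrow> (real ^ 'd) set \<Rightarrow> real" where
  "value_jump u E E' = u E' - u E"

text \<open>In the following, \<open>N\<close> is the set of neighbors of \<open>E\<close> and \<open>\<omega> E'\<close> is the weight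
  \<open>\<omega>\<close> of the pair \<open>(E, E')\<close> for the fixed cell \<open>E\<close>.\<close>

definition admissible_weights ::
  "(real ^ 'd) set set \<Rightarrow> (real ^ 'd) set \<Rightarrow> ((real ^ 'd) set \<Rightarrow> real) \<Rightarrow> bool" where
  "admissible_weights N E \<omega> \<longleftrightarrow>
     (\<forall>E'\<in>N. \<omega> E' \<ge> 0) \<and> span {\<omega> E' *\<^sub>R displacement E E' | E'. E' \<in> N} = UNIV"

definition qp_matrix ::
  "(real ^ 'd) set set \<Rightarrow> (real ^ 'd) set \<Rightarrow> ((real ^ 'd) set \<Rightarrow> real) \<Rightarrow> real ^ 'd ^ 'd" where
  "qp_matrix N E \<omega> =
     (\<Sum>E'\<in>N. \<omega> E' *\<^sub>R outer_product (displacement E E') (displacement E E'))"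

definition qp_vector ::
  "(real ^ 'd) set set \<Rightarrow> (real ^ 'd) set \<Rightarrow> ((real ^ 'd) set \<Rightarrow> real) \<Rightarrow>
   ((real ^ 'd) set \<Rightarrow> real) \<Rightarrow> real ^ 'd" where
  "qp_vector N E u \<omega> = (\<Sum>E'\<in>N. (\<omega> E' * value_jump u E E') *\<^sub>R displacement E E')"

definition qp_objective ::
  "(real ^ 'd) set set \<Rightarrow> (real ^ 'd) set \<Rightarrow> ((real ^ 'd) set \<Rightarrow> real) \<Rightarrow>
   ((real ^ 'd) set \<Rightarrow> real) \<Rightarrow> real ^ 'd \<Rightarrow> real" where
  "qp_objective N E u \<omega> w =
     1 / 2 * (w \<bullet> (qp_matrix N E \<omega> *v w)) - qp_vector N E u \<omega> \<bullet> w"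

definition qp_feasible ::
  "(real \<Rightarrow> real) \<Rightarrow> (real ^ 'd) set set \<Rightarrow> (real ^ 'd) set \<Rightarrow>
   ((real ^ 'd) set \<Rightarrow> real) \<Rightarrow> real ^ 'd \<Rightarrow> bool" where
  "qp_feasible s N E u w \<longleftrightarrow>
     (\<forall>E'\<in>N. 0 \<le> s (value_jump u E E') * (displacement E E' \<bullet> w) \<and>
             s (value_jump u E E') * (displacement E E' \<bullet> w) \<le> \<bar>value_jump u E E'\<bar>)"

definition qp_solution ::
  "(real \<Rightarrow> real) \<Rightarrow> (real ^ 'd) set set \<Rightarrow> (real ^ 'd) set \<Rightarrow> ((real ^ 'd) set \<Rightarrow> real) \<Rightarrow>
   ((real ^ 'd) set \<Rightarrow> real) \<Rightarrow> real ^ 'd \<Rightarrow> bool" where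
  "qp_solution s N E u \<omega> w \<longleftrightarrow> is_arg_min (qp_objective N E u \<omega>) (qp_feasible s N E u) w"

end

theory Submission
  imports Defs
begin

text \<open>
  Up to an additive constant, the objective is
  \<open>\<Sum>\<^sub>N \<omega>/2 (d \<bullet> w - m)\<^sup>2\<close>, and feasibility says that every \<open>d \<bullet> w\<close> lies
  between 0 and \<open>m\<close>. On a Cartesian grid \<open>d = \<plusminus>h\<^sub>i e\<^sub>i\<close>, so the constraints decouple
  into: each component of \<open>w\<close> lies between 0 and the minmod of the two one-sided slopes. Taking
  every component equal to its minmod moves all the \<open>d \<bullet> w\<close> as close to their \<open>m\<close> as
  possible, so it minimizes every summand simultaneously. Any other minimizer has the
  same \<open>d \<bullet> w\<close> wherever \<open>\<omega> > 0\<close>, and is therefore the same vector by the spanning condition.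
\<close>

section \<open>Neighbors in a Cartesian grid\<close>

lemma translation_image_cbox:
  fixes a b c :: "'a::euclidean_space"
  shows "(+) c ` cbox a b = cbox (a + c) (b + c)"
  using cbox_translation[of c a b] by (simp add: add.commute)

lemma aff_dim_hyperplane_component:
  "aff_dim {x :: real ^ 'd. x $ i = c} = int CARD('d) - 1"
  using aff_dim_hyperplane[of "axis i 1 :: real ^ 'd" c]
  by (simp add: inner_axis')

text \<open>The second hyperplane does not contain the first, so cutting with it lowers the
  dimension by at least one. This rules out a facet lying in two different coordinate hyperplanes at
  once.\<close>

lemma aff_dim_two_components:
  assumes "i \<noteq> j"
  shows "aff_dim {x :: real ^ 'd. x $ i = c \<and> x $ j = e} \<le> int CARD('d) - 2"
proof -
  let ?S = "{x :: real ^ 'd. x $ i = c}" and ?H = "{x :: real ^ 'd. axis j 1 \<bullet> x = e}"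
  have S: "?S = {x. axis i 1 \<bullet> x = c}" by (simp add: inner_axis')
  have aff: "affine ?S" unfolding S by (rule affine_hyperplane)
  \<comment> \<open>This point satisfies the first equation, but its \<open>j\<close>-th coordinate
    \<open>e + 1\<close> violates the second.\<close>
  have "axis i c + axis j (e + 1) \<in> ?S" "axis i c + axis j (e + 1) \<notin> ?H"
    unfolding mem_Collect_eq inner_axis' using assms by (auto simp: axis_def)
  then have "\<not> ?S \<subseteq> ?H" by blast
  then have "aff_dim (?S \<inter> ?H) \<le> aff_dim ?S - 1"
    using aff_dim_affine_Int_hyperplane[OF aff, of "axis j 1" e] aff_dim_geq[of ?S]
      aff_dim_hyperplane_component[of i c] by auto
  moreover have "?S \<inter> ?H = {x. x $ i = c \<and> x $ j = e}" by (auto simp: inner_axis')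
  ultimately show ?thesis by (simp add: aff_dim_hyperplane_component)
qed

text \<open>The facet is the slice by \<open>x $ i = a $ i + h $ i\<close>, which is the upper face
  of the first box and the lower face of its translate.\<close>

lemma adjacent_cboxes_share_facet:
  fixes a h :: "real ^ 'd"
  assumes h: "\<And>i. h $ i > 0"
  shows "\<exists>F. F face_of cbox a (a + h) \<and>
             F face_of (+) (h $ i *\<^sub>R axis i 1) ` cbox a (a + h) \<and>
             aff_dim F = int CARD('d) - 1"
proof -
  define c where "c = a $ i + h $ i"
  let ?E = "cbox a (a + h)" and ?E' = "(+) (h $ i *\<^sub>R axis i 1) ` cbox a (a + h)"
    and ?H = "{x :: real ^ 'd. axis i 1 \<bullet> x = c}"
  \<comment> \<open>\<open>?U\<close> is the interior of the union of both boxes. Its trace on the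
    hyperplane is nonempty and relatively open, hence of the same dimension as the hyperplane, and
    it lies inside the slice.\<close>
  let ?U = "box a (a + h + h $ i *\<^sub>R axis i 1)"
  have H: "?H = {x. x $ i = c}" by (simp add: inner_axis')
  have nn: "0 \<le> h $ j" for j using h[of j] by simp
  have E': "?E' = cbox (a + h $ i *\<^sub>R axis i 1) (a + h + h $ i *\<^sub>R axis i 1)"
    by (simp only: translation_image_cbox)
  have eq: "?E \<inter> ?H = ?E' \<inter> ?H"
    unfolding E' H using nn by (auto simp: mem_box_cart axis_def c_def split: if_splits)
      (metis add.commute nn add_increasing2 order_refl)+
  have 1: "?E \<inter> ?H face_of ?E"
    by (rule face_of_Int_supporting_hyperplane_le)
      (auto simp: mem_box_cart inner_axis' c_def)
  have 2: "?E' \<inter> ?H face_of ?E'"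
    by (rule face_of_Int_supporting_hyperplane_ge)
      (auto simp: E' mem_box_cart inner_axis' c_def dest: spec[of _ i])
  have "(\<chi> j. if j = i then c else a $ j + h $ j / 2) \<in> ?H \<inter> ?U"
    unfolding H using h by (auto simp: mem_box_cart axis_def c_def)
  then have "aff_dim (?H \<inter> ?U) = aff_dim ?H"
    by (intro aff_dim_convex_Int_open) (auto simp: convex_hyperplane)
  moreover have "?H \<inter> ?U \<subseteq> ?E \<inter> ?H"
    unfolding H by (auto simp: mem_box_cart axis_def c_def less_imp_le split: if_splits)
      (smt (verit, best) h mult_zero_right)+
  ultimately have "aff_dim (?E \<inter> ?H) \<ge> aff_dim ?H"
    using aff_dim_subset by metis
  moreover have "aff_dim (?E \<inter> ?H) \<le> aff_dim ?H"
    by (intro aff_dim_subset) auto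
  ultimately have "aff_dim (?E \<inter> ?H) = int CARD('d) - 1"
    using aff_dim_hyperplane_component[of i c] H by simp
  with 1 2 eq show ?thesis by auto
qed

text \<open>A common point bounds every entry of \<open>k\<close> by 1 in absolute value. A nonzero
  entry means that the boxes only touch in that direction, which fixes that coordinate on
  \<open>F\<close>; two nonzero entries would force codimension at least 2.\<close>

lemma common_facet_imp_lattice_unit:
  fixes a h :: "real ^ 'd" and k :: "int ^ 'd"
  assumes h: "\<And>i. h $ i > 0"
    and F: "F \<subseteq> cbox a (a + h)" "F \<subseteq> (+) (lattice_vector h k) ` cbox a (a + h)"
    and dim: "aff_dim F = int CARD('d) - 1"
    and k: "k \<noteq> 0"
  obtains i where "k = axis i 1 \<or> k = axis i (-1)"
proof -
  have F': "a $ i \<le> x $ i" "x $ i \<le> a $ i + h $ i"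
      "a $ i + of_int (k $ i) * h $ i \<le> x $ i"
      "x $ i \<le> a $ i + of_int (k $ i) * h $ i + h $ i" if "x \<in> F" for x i
    using F that
    by (auto simp: mem_box_cart lattice_vector_def translation_image_cbox subset_iff algebra_simps)
  have "F \<noteq> {}" using dim by (auto simp: aff_dim_empty)
  then obtain y where y: "y \<in> F" by blast
  have small: "k $ i \<in> {-1, 0, 1}" for i
  proof -
    have "of_int (k $ i) * h $ i \<le> 1 * h $ i" "(-1) * h $ i \<le> of_int (k $ i) * h $ i"
      using F'[OF y, of i] by auto
    then have "real_of_int (k $ i) \<le> 1" "-1 \<le> real_of_int (k $ i)"
      using h[of i] by (simp_all only: mult_le_cancel_right)
    then show ?thesis by auto
  qed
  have pin: "\<exists>c. \<forall>x\<in>F. x $ i = c" if "k $ i \<noteq> 0" for i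
  proof (cases "k $ i = 1")
    case True
    then have "x $ i = a $ i + h $ i" if "x \<in> F" for x
      using F'[OF that, of i] by simp
    then show ?thesis by blast
  next
    case False
    with small[of i] that have "k $ i = -1" by auto
    then have "x $ i = a $ i" if "x \<in> F" for x
      using F'[OF that, of i] by simp
    then show ?thesis by blast
  qed
  obtain i where i: "k $ i \<noteq> 0" using k by (auto simp: vec_eq_iff)
  have "k $ j = 0" if "j \<noteq> i" for j
  proof (rule ccontr)
    assume "k $ j \<noteq> 0"
    with pin i obtain c e where "\<forall>x\<in>F. x $ i = c" "\<forall>x\<in>F. x $ j = e" by meson
    then have "F \<subseteq> {x. x $ i = c \<and> x $ j = e}" by blast
    then have "aff_dim F \<le> int CARD('d) - 2"
      by (rule order_trans[OF aff_dim_subset aff_dim_two_components]) (use that in simp)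
    with dim show False by simp
  qed
  then have "k = axis i (k $ i)" by (auto simp: vec_eq_iff axis_def)
  moreover have "k $ i = 1 \<or> k $ i = -1" using small[of i] i by auto
  ultimately show thesis using that[of i] by (metis (full_types))
qed

lemma lattice_vector_axis [simp]:
  "lattice_vector h (axis i c) = (of_int c * h $ i) *\<^sub>R axis i 1"
  by (auto simp: lattice_vector_def axis_def vec_eq_iff)

lemma lattice_vector_add: "lattice_vector h (k + l) = lattice_vector h k + lattice_vector h l"
  by (simp add: lattice_vector_def vec_eq_iff algebra_simps)

lemma translation_image_cbox_eq_iff:
  fixes a b c :: "real ^ 'd"
  assumes "cbox a b \<noteq> {}"
  shows "(+) c ` cbox a b = cbox a b \<longleftrightarrow> c = 0"
  using assms by (auto simp: translation_image_cbox eq_cbox)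

text \<open>Grid cells are lattice translates of \<open>E\<close>, so ghost cells are as well. The
  dimension of the shared face then singles out the unit steps, and every unit step does produce
  such a face.\<close>

lemma neighbors_cartesian_grid:
  fixes h :: "real ^ 'd"
  assumes h: "\<And>i. h $ i > 0" and G: "cartesian_grid h G" and E: "E \<in> G"
  shows "neighbors h G E = range (cell_plus h E) \<union> range (cell_minus h E)"
proof -
  obtain a where Ea: "E = cbox a (a + h)"
    using G E unfolding cartesian_grid_def by blast
  have ne: "E \<noteq> {}"
    using h by (auto simp: Ea interval_ne_empty_cart less_imp_le)
  have ghost: "\<exists>k. E' = (+) (lattice_vector h k) ` E" if g: "E' \<in> with_ghost_cells h G" for E'
  proof -
    obtain k E'' where "E'' \<in> G" and E': "E' = (+) (lattice_vector h k) ` E''"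
      using g unfolding with_ghost_cells_def by blast
    moreover have "\<forall>A\<in>G. \<forall>B\<in>G. \<exists>l. B = (+) (lattice_vector h l) ` A"
      using G unfolding cartesian_grid_def by (rule conjunct2)
    ultimately obtain l where "E'' = (+) (lattice_vector h l) ` E"
      using E by meson
    then have "E' = (+) (lattice_vector h (k + l)) ` E"
      by (simp add: E' lattice_vector_add image_image add.assoc)
    then show ?thesis ..
  qed
  have plus: "cell_plus h E i = (+) (lattice_vector h (axis i 1)) ` E"
    and minus: "cell_minus h E i = (+) (lattice_vector h (axis i (-1))) ` E" for i
    by (simp_all add: cell_plus_def cell_minus_def)
  have ghost': "(+) (lattice_vector h k) ` E \<in> with_ghost_cells h G" for k
    using E unfolding with_ghost_cells_def by blast
  show ?thesis
  proof (intro equalityI subsetI)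
    fix E' assume "E' \<in> neighbors h G E"
    then obtain F where E': "E' \<in> with_ghost_cells h G" "E' \<noteq> E"
      and F: "F face_of E" "F face_of E'" "aff_dim F = int CARD('d) - 1"
      unfolding neighbors_def by blast
    obtain k where k: "E' = (+) (lattice_vector h k) ` E" using ghost E'(1) by blast
    have "k \<noteq> 0" using E'(2) by (auto simp: k lattice_vector_def zero_vec_def[symmetric])
    then obtain i where "k = axis i 1 \<or> k = axis i (-1)"
      using common_facet_imp_lattice_unit[OF h, of F a k] F k Ea
      by (metis face_of_imp_subset)
    then show "E' \<in> range (cell_plus h E) \<union> range (cell_minus h E)"
      using k plus minus by blast
  next
    fix E' assume "E' \<in> range (cell_plus h E) \<union> range (cell_minus h E)"
    then obtain i where "E' = cell_plus h E i \<or> E' = cell_minus h E i" by blast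
    then show "E' \<in> neighbors h G E"
    proof
      assume E': "E' = cell_plus h E i"
      have "E' \<noteq> E"
        using translation_image_cbox_eq_iff[of a "a + h"] ne h[of i]
        by (simp add: E' cell_plus_def Ea)
      then show ?thesis
        using adjacent_cboxes_share_facet[OF h, of a i] ghost'[of "axis i 1"] plus
        unfolding neighbors_def E' by (simp add: cell_plus_def Ea)
    next
      assume E': "E' = cell_minus h E i"
      let ?v = "h $ i *\<^sub>R axis i 1 :: real ^ 'd"
      have ne': "E' \<noteq> E"
        using translation_image_cbox_eq_iff[of a "a + h" "- ?v"] ne h[of i]
        by (simp add: E' cell_minus_def Ea)
      \<comment> \<open>Seen from \<open>E'\<close>, the cell \<open>E\<close> is the plus neighbor,
        so the facet lemma applies with base corner \<open>a - ?v\<close>.\<close>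
      have "E' = cbox (a - ?v) (a - ?v + h)"
        unfolding E' cell_minus_def Ea translation_image_cbox by (simp add: algebra_simps)
      moreover from this have "E = (+) ?v ` cbox (a - ?v) (a - ?v + h)"
        unfolding Ea translation_image_cbox by (simp add: algebra_simps)
      ultimately have "\<exists>F. F face_of E' \<and> F face_of E \<and> aff_dim F = int CARD('d) - 1"
        using adjacent_cboxes_share_facet[OF h, of "a - ?v" i] by simp
      then show ?thesis
        using ne' ghost'[of "axis i (-1)"] minus unfolding neighbors_def by (auto simp: E')
    qed
  qed
qed

text \<open>Translation by \<open>v\<close> adds the volume times \<open>v\<close> to the integral
  of the identity and preserves the volume; dividing by the positive volume leaves
  \<open>v\<close>.\<close>

lemma displacement_translation:
  fixes a b v :: "real ^ 'd"
  assumes "measure lebesgue (cbox a b) > 0"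
  shows "displacement (cbox a b) ((+) v ` cbox a b) = v"
proof -
  let ?E = "cbox a b"
  have "integral ?E (\<lambda>x. x + v) = integral ?E (\<lambda>x. x) + measure lebesgue ?E *\<^sub>R v"
    by (subst integral_add) (auto intro!: integrable_continuous continuous_intros)
  moreover have "integral ((+) v ` ?E) (\<lambda>x. x) = integral ?E (\<lambda>x. x + v)"
    using integral_shift_cbox_plus[of a b "\<lambda>x. x" v]
    by (simp only: translation_image_cbox o_def add.commute[of v])
  moreover have "measure lebesgue ((+) v ` ?E) = measure lebesgue ?E"
    by (simp add: measure_translation)
  ultimately show ?thesis
    using assms by (simp add: displacement_def centroid_def scaleR_right_distrib)
qed

section \<open>The quadratic program\<close>

lemma outer_product_mult_vec: "outer_product a b *v w = (b \<bullet> w) *\<^sub>R a"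
  by (simp add: outer_product_def matrix_vector_mult_def vec_eq_iff inner_vec_def
      sum_distrib_left mult_ac)

lemma sum_matrix_vector_mult: "(\<Sum>x\<in>A. M x) *v (w :: real ^ 'n) = (\<Sum>x\<in>A. M x *v w)"
  by (induction A rule: infinite_finite_induct) (simp_all add: matrix_vector_mult_add_rdistrib)

text \<open>Completing the square in each summand; subtracting the squared jump makes this an exact
  identity rather than one up to a constant.\<close>

lemma qp_objective_eq_sum_squares:
  "qp_objective N E u \<omega> w =
     (\<Sum>E'\<in>N. \<omega> E' / 2 * ((displacement E E' \<bullet> w - value_jump u E E')\<^sup>2 - (value_jump u E E')\<^sup>2))"
proof -
  have "qp_objective N E u \<omega> w =
      (\<Sum>E'\<in>N. 1 / 2 * (\<omega> E' * (displacement E E' \<bullet> w)\<^sup>2)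
        - \<omega> E' * value_jump u E E' * (displacement E E' \<bullet> w))"
    by (simp add: qp_objective_def qp_matrix_def qp_vector_def sum_matrix_vector_mult
        scaleR_matrix_vector_assoc[symmetric] outer_product_mult_vec inner_sum_right
        inner_sum_left sum_subtractf sum_distrib_left inner_commute power2_eq_square mult.assoc)
  also have "\<dots> = (\<Sum>E'\<in>N. \<omega> E' / 2 *
      ((displacement E E' \<bullet> w - value_jump u E E')\<^sup>2 - (value_jump u E E')\<^sup>2))"
    by (intro sum.cong refl) (simp add: power2_eq_square field_simps)
  finally show ?thesis .
qed

text \<open>The segment expresses "between 0 and \<open>m\<close>" for either sign of
  \<open>m\<close>. At \<open>m = 0\<close> both values allowed for \<open>s 0\<close> force
  \<open>t = 0\<close>.\<close>

lemma sign_constraint_iff_closed_segment: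
  assumes "is_sign_function s"
  shows "0 \<le> s m * t \<and> s m * t \<le> \<bar>m\<bar> \<longleftrightarrow> t \<in> closed_segment 0 m"
proof -
  have "s m = 1 \<or> s m = -1" "m > 0 \<Longrightarrow> s m = 1" "m < 0 \<Longrightarrow> s m = -1"
    using assms unfolding is_sign_function_def by auto
  then show ?thesis
    by (cases "m = 0") (auto simp: closed_segment_eq_real_ivl)
qed

text \<open>For arguments of equal sign the segments are nested and the shorter one survives;
  otherwise they meet only in 0. This is how minmod enters the solution.\<close>

lemma closed_segment_0_minmod:
  "closed_segment 0 (minmod a b) = closed_segment 0 a \<inter> closed_segment 0 b"
  by (auto simp: minmod_def closed_segment_eq_real_ivl zero_less_mult_iff sgn_if min_def
      split: if_splits)

lemma mult_mem_closed_segment_0_iff: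
  fixes c x m :: real
  assumes "c \<noteq> 0"
  shows "c * x \<in> closed_segment 0 m \<longleftrightarrow> x \<in> closed_segment 0 (m / c)"
  using assms unfolding closed_segment_def by (auto simp: field_simps)

text \<open>The points 0, \<open>t\<close>, \<open>r\<close>, \<open>m\<close> lie in this order on
  a line, so moving from \<open>t\<close> to \<open>r\<close> strictly approaches
  \<open>m\<close>.\<close>

lemma square_diff_less_of_closed_segment:
  fixes t :: real
  assumes "t \<in> closed_segment 0 r" "r \<in> closed_segment 0 m" "t \<noteq> r"
  shows "(r - m)\<^sup>2 < (t - m)\<^sup>2"
proof -
  have "\<bar>r - m\<bar> < \<bar>t - m\<bar>"
    using assms by (auto simp: closed_segment_eq_real_ivl split: if_splits)
  then show ?thesis by (metis abs_le_square_iff not_le)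
qed

text \<open>Separates the optimization from the grid geometry, which enters only through the
  domination property \<open>dom\<close>.\<close>

lemma qp_solution_iff_dominant:
  assumes fin: "finite N" and \<omega>: "admissible_weights N E \<omega>"
    and s: "is_sign_function s" and W: "qp_feasible s N E u W"
    and dom: "\<And>w E'. qp_feasible s N E u w \<Longrightarrow> E' \<in> N \<Longrightarrow>
      displacement E E' \<bullet> w \<in> closed_segment 0 (displacement E E' \<bullet> W)"
  shows "qp_solution s N E u \<omega> w \<longleftrightarrow> w = W"
proof -
  have \<omega>_nonneg: "\<omega> E' \<ge> 0" if "E' \<in> N" for E'
    using \<omega> that unfolding admissible_weights_def by blast
  have Wseg: "displacement E E' \<bullet> W \<in> closed_segment 0 (value_jump u E E')" if "E' \<in> N" for E'
    using W that sign_constraint_iff_closed_segment[OF s] unfolding qp_feasible_def by blast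
  have less: "qp_objective N E u \<omega> W < qp_objective N E u \<omega> w"
    if w: "qp_feasible s N E u w" and ne: "w \<noteq> W" for w
  proof -
    \<comment> \<open>Otherwise \<open>w - W\<close> would be orthogonal to a spanning set, hence to
      itself. The resulting \<open>E0\<close> supplies the strict summand below.\<close>
    have "\<exists>E'\<in>N. \<omega> E' \<noteq> 0 \<and> displacement E E' \<bullet> w \<noteq> displacement E E' \<bullet> W"
    proof (rule ccontr)
      assume "\<not> ?thesis"
      then have "orthogonal (w - W) (\<omega> E' *\<^sub>R displacement E E')" if "E' \<in> N" for E'
        using that by (auto simp: orthogonal_def inner_diff_left inner_commute[of "displacement E E'"])
      moreover have "w - W \<in> span {\<omega> E' *\<^sub>R displacement E E' | E'. E' \<in> N}"
        using \<omega> unfolding admissible_weights_def by simp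
      ultimately have "orthogonal (w - W) (w - W)"
        by (elim orthogonal_to_span) blast
      with ne show False by (simp add: orthogonal_self)
    qed
    then obtain E0 where E0: "E0 \<in> N" "\<omega> E0 \<noteq> 0"
      "displacement E E0 \<bullet> w \<noteq> displacement E E0 \<bullet> W" by blast
    show ?thesis
      unfolding qp_objective_eq_sum_squares
    proof (rule sum_strict_mono_ex1[OF fin])
      show "\<forall>E'\<in>N. \<omega> E' / 2 *
          ((displacement E E' \<bullet> W - value_jump u E E')\<^sup>2 - (value_jump u E E')\<^sup>2)
          \<le> \<omega> E' / 2 *
          ((displacement E E' \<bullet> w - value_jump u E E')\<^sup>2 - (value_jump u E E')\<^sup>2)"
      proof
        fix E' assume E': "E' \<in> N"
        have "(displacement E E' \<bullet> W - value_jump u E E')\<^sup>2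
            \<le> (displacement E E' \<bullet> w - value_jump u E E')\<^sup>2"
          using square_diff_less_of_closed_segment[OF dom[OF w E'] Wseg[OF E']]
          by (cases "displacement E E' \<bullet> w = displacement E E' \<bullet> W") auto
        then show "\<omega> E' / 2 *
            ((displacement E E' \<bullet> W - value_jump u E E')\<^sup>2 - (value_jump u E E')\<^sup>2)
            \<le> \<omega> E' / 2 *
            ((displacement E E' \<bullet> w - value_jump u E E')\<^sup>2 - (value_jump u E E')\<^sup>2)"
          using \<omega>_nonneg[OF E'] by (intro mult_left_mono) auto
      qed
      have "\<omega> E0 > 0" using \<omega>_nonneg E0 by force
      then show "\<exists>E'\<in>N. \<omega> E' / 2 *
          ((displacement E E' \<bullet> W - value_jump u E E')\<^sup>2 - (value_jump u E E')\<^sup>2)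
          < \<omega> E' / 2 *
          ((displacement E E' \<bullet> w - value_jump u E E')\<^sup>2 - (value_jump u E E')\<^sup>2)"
        using square_diff_less_of_closed_segment[OF dom[OF w E0(1)] Wseg[OF E0(1)] E0(3)]
        by (intro bexI[OF _ E0(1)] mult_strict_left_mono) auto
    qed
  qed
  show ?thesis
    \<comment> \<open>The strict inequality against every other feasible point gives both minimality
      and uniqueness of \<open>W\<close>.\<close>
    unfolding qp_solution_def is_arg_min_def using W less by (metis order.asym)
qed

theorem theorem3p3:
  fixes h :: "real ^ 'd"
    and G :: "(real ^ 'd) set set"
    and E :: "(real ^ 'd) set"
    and u :: "(real ^ 'd) set \<Rightarrow> real"
    and \<omega> :: "(real ^ 'd) set \<Rightarrow> real"
    and s :: "real \<Rightarrow> real"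
  assumes "\<And>i. h $ i > 0"
    and "cartesian_grid h G"
    and "E \<in> G"
    and "is_sign_function s"
    and "admissible_weights (neighbors h G E) E \<omega>"
  shows "neighbors h G E = range (cell_plus h E) \<union> range (cell_minus h E) \<and>
    (\<forall>w. qp_solution s (neighbors h G E) E u \<omega> w \<longleftrightarrow>
       w = (\<Sum>i\<in>UNIV. minmod ((u (cell_plus h E i) - u E) / h $ i)
                             ((u E - u (cell_minus h E i)) / h $ i) *\<^sub>R axis i 1)) \<and>
    (\<forall>\<omega>'. admissible_weights (neighbors h G E) E \<omega>' \<longrightarrow>
       (\<forall>w. qp_solution s (neighbors h G E) E u \<omega>' w \<longleftrightarrow>
            qp_solution s (neighbors h G E) E u \<omega> w))"
proof -
  note h = assms(1) and s = assms(4)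
  define N where "N = neighbors h G E"
  define W :: "real ^ 'd" where "W = (\<Sum>i\<in>UNIV. minmod ((u (cell_plus h E i) - u E) / h $ i)
    ((u E - u (cell_minus h E i)) / h $ i) *\<^sub>R axis i 1)"
  have N: "N = range (cell_plus h E) \<union> range (cell_minus h E)"
    unfolding N_def using assms(1-3) by (rule neighbors_cartesian_grid)
  obtain a where Ea: "E = cbox a (a + h)"
    using assms(2,3) unfolding cartesian_grid_def by blast
  have "measure lebesgue E > 0"
    using h by (simp add: Ea content_cbox_cart interval_ne_empty_cart less_imp_le prod_pos)
  then have disp: "displacement E (cell_plus h E i) = h $ i *\<^sub>R axis i 1"
    "displacement E (cell_minus h E i) = - (h $ i *\<^sub>R axis i 1)" for i
    unfolding Ea cell_plus_def cell_minus_def by (simp_all only: displacement_translation)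
  have W_nth: "W $ i = minmod ((u (cell_plus h E i) - u E) / h $ i)
      ((u E - u (cell_minus h E i)) / h $ i)" for i
    by (simp add: W_def axis_def if_distrib cong: if_cong)
  have feasible: "qp_feasible s N E u w \<longleftrightarrow> (\<forall>i. w $ i \<in> closed_segment 0 (W $ i))" for w
  proof -
    \<comment> \<open>The negative factor \<open>- h $ i\<close> of the minus neighbor turns its
      jump into the backward difference quotient. For each axis the two segments then intersect in
      the one ending at the minmod slope.\<close>
    have "h $ i * w $ i \<in> closed_segment 0 (u (cell_plus h E i) - u E) \<longleftrightarrow>
          w $ i \<in> closed_segment 0 ((u (cell_plus h E i) - u E) / h $ i)"
      and "- h $ i * w $ i \<in> closed_segment 0 (u (cell_minus h E i) - u E) \<longleftrightarrow>
          w $ i \<in> closed_segment 0 ((u E - u (cell_minus h E i)) / h $ i)" for i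
      using h[of i] mult_mem_closed_segment_0_iff[of "h $ i"]
        mult_mem_closed_segment_0_iff[of "- h $ i" "w $ i" "u (cell_minus h E i) - u E"]
      by (simp_all add: minus_divide_left)
    then show ?thesis
      unfolding qp_feasible_def sign_constraint_iff_closed_segment[OF s] N value_jump_def
        W_nth closed_segment_0_minmod
      by (auto simp: ball_Un disp inner_axis')
  qed
  have dom: "displacement E E' \<bullet> w \<in> closed_segment 0 (displacement E E' \<bullet> W)"
    if feas: "qp_feasible s N E u w" and E': "E' \<in> N" for w E'
  proof -
    have w: "w $ i \<in> closed_segment 0 (W $ i)" for i using feas feasible by blast
    obtain i c where "c \<noteq> 0" "displacement E E' = c *\<^sub>R axis i 1"
    proof -
      obtain i where "E' = cell_plus h E i \<or> E' = cell_minus h E i" using E' N by blast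
      then have "displacement E E' = h $ i *\<^sub>R axis i 1 \<or>
          displacement E E' = (- h $ i) *\<^sub>R axis i 1"
        using disp by auto
      then show ?thesis using h[of i] that[of "h $ i" i] that[of "- h $ i" i] by auto
    qed
    \<comment> \<open>Inner products with \<open>c *\<^sub>R axis i 1\<close> only rescale the
      \<open>i\<close>-th component by \<open>c\<close>, and betweenness survives this
      scaling.\<close>
    then show ?thesis
      using w[of i] mult_mem_closed_segment_0_iff[of c "w $ i" "c * W $ i"]
      by (simp add: inner_axis')
  qed
  have "finite N" unfolding N by simp
  moreover have "qp_feasible s N E u W" by (simp add: feasible)
  \<comment> \<open>\<open>W\<close> does not mention the weights, so proving this for arbitrary
    admissible \<open>\<omega>'\<close> yields the independence claim together with the
    formula.\<close>
  ultimately have sol: "qp_solution s N E u \<omega>' w \<longleftrightarrow> w = W"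
    if "admissible_weights N E \<omega>'" for \<omega>' w
    using qp_solution_iff_dominant[OF _ that s _ dom] by blast
  show ?thesis
    using N sol assms(5) unfolding N_def W_def by simp
qed

end
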